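(* Let $\alpha,\beta\in\mathcal{CP}_n$, each having exactly $p$ kernel blocks ($1\le p\le n$). Then $(\alpha,\beta)\in\mathcal{L}$ in the semigroup $\mathcal{CP}_n$ if and only if there exist $\gamma_1,\gamma_2\in\mathcal{CP}_n$ and an integer $s\ge p$ such that $\mathbf{Ker}\,\gamma_1$ and $\mathbf{Ker}\,\gamma_2$ are refinements, each with $s$ blocks, of $\mathbf{Ker}\,\alpha$ and $\mathbf{Ker}\,\beta$ respectively, having admissible transversals $A_\alpha=\{\tau_1<\cdots<\tau_s\}$ of $\mathbf{Ker}\,\gamma_1$ and $B_\beta=\{\sigma_1<\cdots<\sigma_s\}$ of $\mathbf{Ker}\,\gamma_2$, such that either (a) the map $\tau_i\mapsto\sigma_i$ is a translation and $\tau_i\alpha=\sigma_i\beta$ for all $i=1,\ldots,s$; or (b) the map $\tau_i\mapsto\sigma_{s-i+1}$ is a reflection and $\tau_i\alpha=\sigma_{s-i+1}\beta$ for all $i=1,\ldots,s$.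
   Context: $[n]=\{1,\ldots,n\}$. $\mathcal{P}_n$ is the semigroup of all partial transformations of $[n]$ (maps whose domain and image are subsets of $[n]$), written on the right and composed left to right: $x(\alpha\beta)=(x\alpha)\beta$. $\mathcal{CP}_n=\{\alpha\in\mathcal{P}_n : |x\alpha-y\alpha|\le|x-y| \text{ for all } x,y\in\mathrm{Dom}\,\alpha\}$ is the subsemigroup of partial contractions. For $\alpha\in\mathcal{P}_n$, $\mathbf{Ker}\,\alpha$ is the partition of $\mathrm{Dom}\,\alpha$ into the nonempty fibres (kernel blocks) of $\alpha$. A refinement (finer partition) of $\mathbf{Ker}\,\alpha$ is a partition of the same set $\mathrm{Dom}\,\alpha$ each of whose blocks is contained in a block of $\mathbf{Ker}\,\alpha$. A transversal of a partition is a set containing exactly one element of each block (and no other elements); a transversal $\{t_i\}$ of a partition with blocks $\{C_i\}$, $t_i\in C_i$, is admissible if $|t_i-t_j|\le|c_i-c_j|$ for all $i,j$ and all $c_i\in C_i$, $c_j\in C_j$. A translation is a map of the form $x\mapsto x+e$ and a reflection is a map of the form $x\mapsto e-x$, for some fixed $e\in\mathbb{Z}$. Green's relation $\mathcal{L}$ on a semigroup $S$: $(a,b)\in\mathcal{L}$ iff $S^1a=S^1b$. *)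

theory Defs
  imports Main "HOL-Library.Disjoint_Sets"
begin

text \<open>Partial transformations of $[n]$ are partial maps on \<open>int\<close> whose domain and range lie in
  \<open>{1..int n}\<close>; the integers are used so that distances and shifts by a negative amount need no
  coercions. The value $x\alpha$ is \<open>\<alpha> x :: int option\<close>.\<close>

definition partial_transformations :: "nat \<Rightarrow> (int \<rightharpoonup> int) set" where
  "partial_transformations n = {\<alpha>. dom \<alpha> \<subseteq> {1..int n} \<and> ran \<alpha> \<subseteq> {1..int n}}"

definition partial_contractions :: "nat \<Rightarrow> (int \<rightharpoonup> int) set" where
  "partial_contractions n = {\<alpha> \<in> partial_transformations n.
     \<forall>x\<in>dom \<alpha>. \<forall>y\<in>dom \<alpha>. \<bar>the (\<alpha> x) - the (\<alpha> y)\<bar> \<le> \<bar>x - y\<bar>}"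

text \<open>Maps act on the right, so the product $\alpha\beta$ applies $\alpha$ first.\<close>

definition pmult :: "('a \<rightharpoonup> 'a) \<Rightarrow> ('a \<rightharpoonup> 'a) \<Rightarrow> ('a \<rightharpoonup> 'a)" where
  "pmult \<alpha> \<beta> = \<beta> \<circ>\<^sub>m \<alpha>"

text \<open>The principal left ideal $S^1 a$; the adjoined identity contributes $a$ itself.\<close>

definition left_ideal :: "('a \<Rightarrow> 'a \<Rightarrow> 'a) \<Rightarrow> 'a set \<Rightarrow> 'a \<Rightarrow> 'a set" where
  "left_ideal mul S a = insert a {mul s a | s. s \<in> S}"

definition green_L :: "('a \<Rightarrow> 'a \<Rightarrow> 'a) \<Rightarrow> 'a set \<Rightarrow> ('a \<times> 'a) set" where
  "green_L mul S = {(a, b). a \<in> S \<and> b \<in> S \<and> left_ideal mul S a = left_ideal mul S b}"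

definition Ker :: "('a \<rightharpoonup> 'b) \<Rightarrow> 'a set set" where
  "Ker \<alpha> = {{x. \<alpha> x = Some y} | y. y \<in> ran \<alpha>}"

definition transversal :: "'a set set \<Rightarrow> 'a set \<Rightarrow> bool" where
  "transversal P T \<longleftrightarrow> T \<subseteq> \<Union>P \<and> (\<forall>C\<in>P. \<exists>!t. t \<in> T \<inter> C)"

definition admissible_transversal :: "int set set \<Rightarrow> int set \<Rightarrow> bool" where
  "admissible_transversal P T \<longleftrightarrow> transversal P T \<and>
     (\<forall>C\<in>P. \<forall>D\<in>P. \<forall>t\<in>T \<inter> C. \<forall>u\<in>T \<inter> D. \<forall>c\<in>C. \<forall>d\<in>D. \<bar>t - u\<bar> \<le> \<bar>c - d\<bar>)"

text \<open>\<open>increasing_enum s \<tau> A\<close> says $A = \{\tau_1 < \cdots < \tau_s\}$.\<close>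

definition increasing_enum :: "nat \<Rightarrow> (nat \<Rightarrow> int) \<Rightarrow> int set \<Rightarrow> bool" where
  "increasing_enum s \<tau> A \<longleftrightarrow> strict_mono_on {1..s} \<tau> \<and> A = \<tau> ` {1..s}"

end

(* If \<alpha> = \<gamma>\<beta> and \<beta> = \<delta>\<alpha>, some power \<epsilon> = (\<gamma>\<delta>)^k is idempotent and satisfies \<epsilon>\<alpha> = \<alpha>.  The image of an
   idempotent contraction is an admissible transversal of its kernel, and \<gamma> restricted to the image
   of \<epsilon> is a contraction with a contracting inverse, hence an isometry between sets of integers,
   that is, a translation or a reflection.  Conversely, sending each block of Ker \<gamma>\<^sub>1 to the image of
   its representative under the translation or reflection is a contraction \<delta> with \<delta>\<beta> = \<alpha>. *)
theory Submission
  imports Defs "HOL-Library.FuncSet"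
begin

section \<open>The monoid of partial contractions and divisibility in it\<close>

lemma partial_contractions_iff:
  "\<alpha> \<in> partial_contractions n \<longleftrightarrow> dom \<alpha> \<subseteq> {1..int n} \<and>
     (\<forall>x\<in>dom \<alpha>. the (\<alpha> x) \<in> {1..int n}) \<and>
     (\<forall>x\<in>dom \<alpha>. \<forall>y\<in>dom \<alpha>. \<bar>the (\<alpha> x) - the (\<alpha> y)\<bar> \<le> \<bar>x - y\<bar>)"
proof -
  have "ran \<alpha> = (\<lambda>x. the (\<alpha> x)) ` dom \<alpha>" by (force simp: ran_def)
  then show ?thesis
    unfolding partial_contractions_def partial_transformations_def by (simp add: image_subset_iff)
qed

lemma restrict_Some_in_partial_contractions:
  assumes "D \<subseteq> {1..int n}" "f ` D \<subseteq> {1..int n}"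
    and "\<And>x y. x \<in> D \<Longrightarrow> y \<in> D \<Longrightarrow> \<bar>f x - f y\<bar> \<le> \<bar>x - y\<bar>"
  shows "(Some \<circ> f) |` D \<in> partial_contractions n"
  using assms unfolding partial_contractions_iff by (auto simp: image_subset_iff)

lemma pmult_assoc: "pmult (pmult \<alpha> \<beta>) \<gamma> = pmult \<alpha> (pmult \<beta> \<gamma>)"
  unfolding pmult_def map_comp_def by (auto split: option.splits)

lemma pmult_in_partial_contractions:
  assumes "\<alpha> \<in> partial_contractions n" "\<beta> \<in> partial_contractions n"
  shows "pmult \<alpha> \<beta> \<in> partial_contractions n"
proof -
  have d: "x \<in> dom \<alpha> \<and> the (\<alpha> x) \<in> dom \<beta> \<and> the (pmult \<alpha> \<beta> x) = the (\<beta> (the (\<alpha> x)))"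
    if "x \<in> dom (pmult \<alpha> \<beta>)" for x
    using that by (auto simp: pmult_def map_comp_def split: option.splits)
  show ?thesis unfolding partial_contractions_iff
  proof (intro conjI ballI)
    show "dom (pmult \<alpha> \<beta>) \<subseteq> {1..int n}"
      using d assms(1) unfolding partial_contractions_iff by blast
    show "the (pmult \<alpha> \<beta> x) \<in> {1..int n}" if "x \<in> dom (pmult \<alpha> \<beta>)" for x
      using d[OF that] assms(2) unfolding partial_contractions_iff by metis
    show "\<bar>the (pmult \<alpha> \<beta> x) - the (pmult \<alpha> \<beta> y)\<bar> \<le> \<bar>x - y\<bar>"
      if "x \<in> dom (pmult \<alpha> \<beta>)" "y \<in> dom (pmult \<alpha> \<beta>)" for x y
    proof -
      have "\<bar>the (\<beta> (the (\<alpha> x))) - the (\<beta> (the (\<alpha> y)))\<bar> \<le> \<bar>the (\<alpha> x) - the (\<alpha> y)\<bar>"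
        using d[OF that(1)] d[OF that(2)] assms(2) unfolding partial_contractions_iff by blast
      also have "\<dots> \<le> \<bar>x - y\<bar>"
        using d[OF that(1)] d[OF that(2)] assms(1) unfolding partial_contractions_iff by blast
      finally show ?thesis using d[OF that(1)] d[OF that(2)] by simp
    qed
  qed
qed

text \<open>The identity map of the whole set is itself a contraction, so the semigroup is already a
  monoid and adjoining an identity adds nothing to a principal left ideal.\<close>

lemma pmult_identity_left:
  assumes "\<alpha> \<in> partial_contractions n"
  shows "(Some \<circ> id) |` {1..int n} \<in> partial_contractions n"
    and "pmult ((Some \<circ> id) |` {1..int n}) \<alpha> = \<alpha>"
proof -
  show "(Some \<circ> id) |` {1..int n} \<in> partial_contractions n"
    by (rule restrict_Some_in_partial_contractions) auto
  show "pmult ((Some \<circ> id) |` {1..int n}) \<alpha> = \<alpha>"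
  proof
    fix x show "pmult ((Some \<circ> id) |` {1..int n}) \<alpha> x = \<alpha> x"
    proof (cases "x \<in> {1..int n}")
      case False
      then have "\<alpha> x = None" using assms unfolding partial_contractions_iff by blast
      with False show ?thesis by (simp add: pmult_def)
    qed (simp add: pmult_def)
  qed
qed

text \<open>In a monoid, inclusion of principal left ideals is left divisibility of the generators;
  associativity and closure carry a factorisation of \<open>x\<close> over to every left multiple of
  \<open>x\<close>.\<close>

lemma green_L_partial_contractions_iff:
  assumes a: "\<alpha> \<in> partial_contractions n" and b: "\<beta> \<in> partial_contractions n"
  shows "(\<alpha>, \<beta>) \<in> green_L pmult (partial_contractions n) \<longleftrightarrow>
    (\<exists>\<gamma>\<in>partial_contractions n. \<alpha> = pmult \<gamma> \<beta>) \<and> (\<exists>\<delta>\<in>partial_contractions n. \<beta> = pmult \<delta> \<alpha>)"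
proof -
  let ?S = "partial_contractions n"
  have ideal: "left_ideal pmult ?S x = {pmult s x | s. s \<in> ?S}" if "x \<in> ?S" for x
    using pmult_identity_left[OF that] unfolding left_ideal_def by force
  have le: "left_ideal pmult ?S x \<subseteq> left_ideal pmult ?S y \<longleftrightarrow> (\<exists>\<gamma>\<in>?S. x = pmult \<gamma> y)"
    if x: "x \<in> ?S" and y: "y \<in> ?S" for x y
  proof
    assume "left_ideal pmult ?S x \<subseteq> left_ideal pmult ?S y"
    moreover have "x \<in> left_ideal pmult ?S x" by (simp add: left_ideal_def)
    ultimately show "\<exists>\<gamma>\<in>?S. x = pmult \<gamma> y" unfolding ideal[OF y] by blast
  next
    assume "\<exists>\<gamma>\<in>?S. x = pmult \<gamma> y"
    then obtain \<gamma> where g: "\<gamma> \<in> ?S" "x = pmult \<gamma> y" by blast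
    show "left_ideal pmult ?S x \<subseteq> left_ideal pmult ?S y"
    proof
      fix z assume "z \<in> left_ideal pmult ?S x"
      then obtain s where "s \<in> ?S" "z = pmult s x" unfolding ideal[OF x] by blast
      then have "pmult s \<gamma> \<in> ?S" "z = pmult (pmult s \<gamma>) y"
        using g by (simp_all add: pmult_in_partial_contractions pmult_assoc)
      then show "z \<in> left_ideal pmult ?S y" unfolding ideal[OF y] by blast
    qed
  qed
  show ?thesis unfolding green_L_def using a b le[OF a b] le[OF b a] by auto
qed

section \<open>Kernels, refinements and left factors\<close>

lemma partition_on_Ker: "partition_on (dom \<alpha>) (Ker \<alpha>)"
proof (rule partition_onI)
  show "\<Union>(Ker \<alpha>) = dom \<alpha>" unfolding Ker_def ran_def by blast
  show "\<And>C E. C \<in> Ker \<alpha> \<Longrightarrow> E \<in> Ker \<alpha> \<Longrightarrow> C \<noteq> E \<Longrightarrow> disjnt C E"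
    unfolding Ker_def disjnt_def by auto
  show "{} \<notin> Ker \<alpha>" unfolding Ker_def ran_def by blast
qed

lemma card_Ker: "card (Ker \<alpha>) = card (ran \<alpha>)"
proof -
  have "Ker \<alpha> = (\<lambda>y. {x. \<alpha> x = Some y}) ` ran \<alpha>" unfolding Ker_def by blast
  moreover have "inj_on (\<lambda>y. {x. \<alpha> x = Some y}) (ran \<alpha>)"
    by (rule inj_onI) (force simp: ran_def)
  ultimately show ?thesis by (simp add: card_image)
qed

text \<open>Values are compared as options, so \<open>\<gamma> x = \<gamma> y\<close> with
  \<open>x\<close> in the domain already forces \<open>y\<close> into it.\<close>

lemma refines_KerI:
  assumes "dom \<gamma> = dom \<alpha>" and "\<And>x y. x \<in> dom \<gamma> \<Longrightarrow> \<gamma> x = \<gamma> y \<Longrightarrow> \<alpha> x = \<alpha> y"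
  shows "refines (dom \<alpha>) (Ker \<gamma>) (Ker \<alpha>)"
  unfolding refines_def
proof (intro conjI ballI)
  show "partition_on (dom \<alpha>) (Ker \<gamma>)" using partition_on_Ker[of \<gamma>] assms(1) by simp
  show "partition_on (dom \<alpha>) (Ker \<alpha>)" by (rule partition_on_Ker)
  fix C assume "C \<in> Ker \<gamma>"
  then obtain x y where C: "C = {z. \<gamma> z = Some y}" and x: "\<gamma> x = Some y"
    by (auto simp: Ker_def ran_def)
  then have xd: "x \<in> dom \<gamma>" by blast
  then obtain w where w: "\<alpha> x = Some w" using assms(1) by blast
  have "C \<subseteq> {z. \<alpha> z = Some w}"
  proof
    fix z assume "z \<in> C"
    then show "z \<in> {z. \<alpha> z = Some w}" using assms(2)[OF xd, of z] C x w by simp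
  qed
  moreover have "{z. \<alpha> z = Some w} \<in> Ker \<alpha>" using w by (auto simp: Ker_def ran_def)
  ultimately show "\<exists>Y\<in>Ker \<alpha>. C \<subseteq> Y" by blast
qed

lemma same_block_refines:
  assumes "refines (dom \<alpha>) P (Ker \<alpha>)" "C \<in> P" "x \<in> C" "y \<in> C"
  shows "\<alpha> x = \<alpha> y"
proof -
  obtain Y where "Y \<in> Ker \<alpha>" "C \<subseteq> Y" using assms(1,2) unfolding refines_def by meson
  then obtain w where "C \<subseteq> {x. \<alpha> x = Some w}" unfolding Ker_def by blast
  then have "\<alpha> x = Some w" "\<alpha> y = Some w" using assms(3,4) by blast+
  then show ?thesis by simp
qed

text \<open>The factor moves a point to the representative of its block and then applies
  \<open>f\<close>. The first move contracts by admissibility and keeps the value of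
  \<open>\<alpha>\<close>, since the blocks refine its kernel; \<open>f\<close> does not increase
  distances on \<open>A\<close> and turns \<open>\<alpha>\<close> into
  \<open>\<beta>\<close>.\<close>

lemma factor_through_admissible_transversal:
  assumes \<alpha>: "\<alpha> \<in> partial_contractions n" and \<beta>: "\<beta> \<in> partial_contractions n"
    and ref: "refines (dom \<alpha>) P (Ker \<alpha>)" and adm: "admissible_transversal P A"
    and iso: "\<And>a b. a \<in> A \<Longrightarrow> b \<in> A \<Longrightarrow> \<bar>f a - f b\<bar> \<le> \<bar>a - b\<bar>"
    and eq: "\<And>a. a \<in> A \<Longrightarrow> \<alpha> a = \<beta> (f a)"
  shows "\<exists>\<delta>\<in>partial_contractions n. \<alpha> = pmult \<delta> \<beta>"
proof -
  have uniq: "\<forall>C\<in>P. \<exists>!t. t \<in> A \<inter> C"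
    and dist: "\<forall>C\<in>P. \<forall>D\<in>P. \<forall>t\<in>A \<inter> C. \<forall>u\<in>A \<inter> D. \<forall>c\<in>C. \<forall>d\<in>D. \<bar>t - u\<bar> \<le> \<bar>c - d\<bar>"
    using adm unfolding admissible_transversal_def transversal_def by simp_all
  have U: "\<Union>P = dom \<alpha>" using ref by (auto simp: refines_def partition_on_def)
  have "\<exists>C t. C \<in> P \<and> x \<in> C \<and> t \<in> A \<inter> C" if "x \<in> dom \<alpha>" for x
  proof -
    from that obtain C where C: "C \<in> P" "x \<in> C" using U by blast
    then have "\<exists>!t. t \<in> A \<inter> C"
      using bspec[OF uniq] by simp
    then obtain t where "t \<in> A \<inter> C" by (elim ex1E)
    with C show ?thesis by (intro exI[of _ C] exI[of _ t] conjI)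
  qed
  \<comment> \<open>A choice of the block \<open>C x\<close> containing \<open>x\<close> and of its
    representative \<open>r x\<close>.\<close>
  then obtain C r where C: "\<And>x. x \<in> dom \<alpha> \<Longrightarrow> C x \<in> P \<and> x \<in> C x \<and> r x \<in> A \<inter> C x" by metis
  have r\<alpha>: "\<alpha> x = \<beta> (f (r x))" if "x \<in> dom \<alpha>" for x
    using same_block_refines[OF ref, of "C x" x "r x"] C[OF that] eq by auto
  \<comment> \<open>Membership comes from the equality of options: where \<open>\<alpha> x\<close>
    is defined, so is \<open>\<beta> (f (r x))\<close>.\<close>
  have in\<beta>: "f (r x) \<in> dom \<beta>" if "x \<in> dom \<alpha>" for x
    using r\<alpha>[OF that] that by (auto simp: dom_def)
  have contr: "\<bar>f (r x) - f (r y)\<bar> \<le> \<bar>x - y\<bar>" if "x \<in> dom \<alpha>" "y \<in> dom \<alpha>" for x y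
  proof -
    have "\<bar>r x - r y\<bar> \<le> \<bar>x - y\<bar>"
      using dist C[OF that(1)] C[OF that(2)] by blast
    then show ?thesis using iso[of "r x" "r y"] C[OF that(1)] C[OF that(2)] by auto
  qed
  let ?\<delta> = "(Some \<circ> (f \<circ> r)) |` dom \<alpha>"
  have "?\<delta> \<in> partial_contractions n"
  proof (rule restrict_Some_in_partial_contractions)
    show "dom \<alpha> \<subseteq> {1..int n}" using \<alpha> unfolding partial_contractions_iff by blast
    have "dom \<beta> \<subseteq> {1..int n}" using \<beta> unfolding partial_contractions_iff by blast
    then show "(f \<circ> r) ` dom \<alpha> \<subseteq> {1..int n}" using in\<beta> by fastforce
  qed (simp add: contr)
  moreover have "\<alpha> = pmult ?\<delta> \<beta>"
  proof
    fix x show "\<alpha> x = pmult ?\<delta> \<beta> x"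
      using r\<alpha>[of x] by (cases "x \<in> dom \<alpha>") (auto simp: pmult_def map_comp_def restrict_map_def)
  qed
  ultimately show ?thesis by blast
qed

text \<open>Replaces the partial factor by a total function, so that it can be composed and iterated
  with \<open>^^\<close>. The default value of \<open>the\<close> is never met on
  \<open>dom \<alpha>\<close>, because a defined product forces \<open>\<gamma>\<close> to be
  defined there.\<close>

lemma pmult_eq_transfers:
  assumes \<alpha>: "\<alpha> = pmult \<gamma> \<beta>" and \<gamma>: "\<gamma> \<in> partial_contractions n"
  obtains g where "g ` dom \<alpha> \<subseteq> dom \<beta>" "\<And>x. x \<in> dom \<alpha> \<Longrightarrow> \<alpha> x = \<beta> (g x)"
    "\<And>x y. x \<in> dom \<alpha> \<Longrightarrow> y \<in> dom \<alpha> \<Longrightarrow> \<bar>g x - g y\<bar> \<le> \<bar>x - y\<bar>"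
proof
  let ?g = "\<lambda>x. the (\<gamma> x)"
  have d: "x \<in> dom \<gamma> \<and> ?g x \<in> dom \<beta> \<and> \<alpha> x = \<beta> (?g x)" if "x \<in> dom \<alpha>" for x
    using that unfolding \<alpha> by (auto simp: pmult_def map_comp_def split: option.splits)
  then show "?g ` dom \<alpha> \<subseteq> dom \<beta>" by blast
  show "\<And>x. x \<in> dom \<alpha> \<Longrightarrow> \<alpha> x = \<beta> (?g x)" using d by blast
  show "\<And>x y. x \<in> dom \<alpha> \<Longrightarrow> y \<in> dom \<alpha> \<Longrightarrow> \<bar>?g x - ?g y\<bar> \<le> \<bar>x - y\<bar>"
    using d \<gamma> unfolding partial_contractions_iff by blast
qed

section \<open>Idempotent powers, retractions and isometries of sets of integers\<close>

lemma funpow_image_subset: "f ` D \<subseteq> D \<Longrightarrow> (f ^^ k) ` D \<subseteq> D"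
proof (induction k)
  case (Suc k)
  have "(f ^^ Suc k) ` D = f ` (f ^^ k) ` D" by (simp add: image_comp)
  with Suc show ?case by blast
qed simp

text \<open>Two powers of \<open>f\<close> coincide on the finite set \<open>D\<close> by the
  pigeonhole principle, so from some exponent on the powers are periodic; any positive multiple of
  the period beyond that exponent yields an idempotent.\<close>

lemma idempotent_power_on_finite:
  assumes fin: "finite D" and f: "f ` D \<subseteq> D"
  obtains k where "k > 0" "\<And>x. x \<in> D \<Longrightarrow> (f ^^ k) ((f ^^ k) x) = (f ^^ k) x"
proof -
  \<comment> \<open>Restriction fixes the values outside \<open>D\<close>, which places all the
    powers in the finite extensional function space on \<open>D\<close>.\<close>
  let ?F = "\<lambda>i. restrict (f ^^ i) D"
  have "range ?F \<subseteq> D \<rightarrow>\<^sub>E D" using funpow_image_subset[OF f] by fastforce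
  then have "finite (range ?F)" using fin by (meson finite_PiE finite_subset)
  then have "\<not> inj ?F" using finite_imageD infinite_UNIV_nat by blast
  then obtain i j where ij: "i < j" "?F i = ?F j"
    unfolding inj_def by (metis linorder_neqE_nat)
  define q where "q = j - i"
  have q: "q > 0" "j = i + q" using ij by (auto simp: q_def)
  have base: "(f ^^ (q + i)) x = (f ^^ i) x" if "x \<in> D" for x
    using fun_cong[OF ij(2), of x] that q by (simp add: add.commute)
  have per: "(f ^^ (q + m)) x = (f ^^ m) x" if "x \<in> D" "i \<le> m" for x m
  proof -
    define d where "d = m - i"
    have m: "m = d + i" using that(2) by (simp add: d_def)
    have "q + m = d + (q + i)" by (simp add: m)
    then have "(f ^^ (q + m)) x = (f ^^ d) ((f ^^ (q + i)) x)"
      by (simp only: funpow_add comp_apply)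
    also have "\<dots> = (f ^^ m) x"
      by (simp only: base[OF that(1)]) (simp add: m funpow_add)
    finally show ?thesis .
  qed
  have mult: "(f ^^ (c * q + m)) x = (f ^^ m) x" if "x \<in> D" "i \<le> m" for x m c
    using that per by (induction c) (auto simp: add.assoc)
  \<comment> \<open>A multiple of the period \<open>q\<close> that is at least \<open>i\<close>;
    \<open>Suc\<close> keeps it positive when \<open>i\<close> is zero.\<close>
  let ?k = "Suc i * q"
  have "i \<le> ?k" using q(1) by (cases q) auto
  then have "(f ^^ ?k) ((f ^^ ?k) x) = (f ^^ ?k) x" if "x \<in> D" for x
    using mult[OF that, of ?k "Suc i"] by (simp only: funpow_add comp_apply)
  moreover have "?k > 0" using q(1) by simp
  ultimately show ?thesis using that by blast
qed

text \<open>The block of \<open>x\<close> contains exactly one fixed point, namely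
  \<open>\<epsilon> x\<close>. The representatives belonging to \<open>c\<close> and
  \<open>d\<close> are thus \<open>\<epsilon> c\<close> and \<open>\<epsilon> d\<close>, and
  admissibility becomes the contraction inequality.\<close>

lemma idempotent_contraction_admissible:
  assumes D: "D \<subseteq> {1..int n}" and eD: "\<epsilon> ` D \<subseteq> D"
    and idem: "\<And>x. x \<in> D \<Longrightarrow> \<epsilon> (\<epsilon> x) = \<epsilon> x"
    and contr: "\<And>x y. x \<in> D \<Longrightarrow> y \<in> D \<Longrightarrow> \<bar>\<epsilon> x - \<epsilon> y\<bar> \<le> \<bar>x - y\<bar>"
  defines "\<gamma> \<equiv> (Some \<circ> \<epsilon>) |` D"
  shows "\<gamma> \<in> partial_contractions n" "admissible_transversal (Ker \<gamma>) (\<epsilon> ` D)"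
    "card (Ker \<gamma>) = card (\<epsilon> ` D)"
proof -
  show "\<gamma> \<in> partial_contractions n"
    unfolding \<gamma>_def using assms by (intro restrict_Some_in_partial_contractions) blast+
  have ran: "ran \<gamma> = \<epsilon> ` D" by (auto simp: \<gamma>_def ran_def restrict_map_def)
  then show "card (Ker \<gamma>) = card (\<epsilon> ` D)" by (simp add: card_Ker)
  have KerD: "\<exists>y\<in>\<epsilon> ` D. C = {x\<in>D. \<epsilon> x = y}" if "C \<in> Ker \<gamma>" for C
  proof -
    from that obtain y where "y \<in> ran \<gamma>" "C = {x. \<gamma> x = Some y}" unfolding Ker_def by blast
    moreover have "{x. \<gamma> x = Some y} = {x\<in>D. \<epsilon> x = y}"
      by (auto simp: \<gamma>_def restrict_map_def)
    ultimately show ?thesis using ran by blast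
  qed
  have fixed: "\<epsilon> t = t" if "t \<in> \<epsilon> ` D" for t using that idem by blast
  show "admissible_transversal (Ker \<gamma>) (\<epsilon> ` D)"
    unfolding admissible_transversal_def transversal_def
  proof (intro conjI ballI)
    have "\<Union>(Ker \<gamma>) = D"
      using partition_onD1[OF partition_on_Ker, of \<gamma>]
      by (auto simp: \<gamma>_def)
    then show "\<epsilon> ` D \<subseteq> \<Union>(Ker \<gamma>)" using eD by simp
  next
    fix C assume "C \<in> Ker \<gamma>"
    then obtain y where y: "y \<in> \<epsilon> ` D" "C = {x\<in>D. \<epsilon> x = y}" using KerD by meson
    have "y \<in> D" using y(1) eD by (rule subsetD[rotated])
    then have "y \<in> \<epsilon> ` D \<inter> C" using y fixed[OF y(1)] by simp
    moreover have "t = y" if "t \<in> \<epsilon> ` D \<inter> C" for t using that y(2) fixed[of t] by simp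
    ultimately show "\<exists>!t. t \<in> \<epsilon> ` D \<inter> C" by (rule ex1I)
  next
    fix C E t u c d
    assume *: "C \<in> Ker \<gamma>" "E \<in> Ker \<gamma>" "t \<in> \<epsilon> ` D \<inter> C" "u \<in> \<epsilon> ` D \<inter> E" "c \<in> C" "d \<in> E"
    obtain y where y: "C = {x\<in>D. \<epsilon> x = y}" using KerD[OF *(1)] by meson
    obtain z where z: "E = {x\<in>D. \<epsilon> x = z}" using KerD[OF *(2)] by meson
    have "\<epsilon> c = t" "\<epsilon> d = u" "c \<in> D" "d \<in> D"
      using * fixed[of t] fixed[of u] unfolding y z by simp_all
    then show "\<bar>t - u\<bar> \<le> \<bar>c - d\<bar>" using contr[of c d] by simp
  qed
qed

text \<open>If one pair of distinct points keeps its oriented difference, the distances to these two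
  points determine every other value. Otherwise every difference changes sign and
  \<open>g x + x\<close> is constant; a singleton falls under this second case.\<close>

lemma isometry_int_translation_or_reflection:
  fixes g :: "int \<Rightarrow> int"
  assumes iso: "\<And>x y. x \<in> A \<Longrightarrow> y \<in> A \<Longrightarrow> \<bar>g x - g y\<bar> = \<bar>x - y\<bar>"
  shows "(\<exists>e. \<forall>x\<in>A. g x = x + e) \<or> (\<exists>e. \<forall>x\<in>A. g x = e - x)"
proof (cases "\<exists>a\<in>A. \<exists>b\<in>A. a \<noteq> b \<and> g b - g a = b - a")
  case True
  then obtain a b where ab: "a \<in> A" "b \<in> A" "a \<noteq> b" "g b - g a = b - a" by blast
  \<comment> \<open>On a line, a point is determined by its distances to two distinct
    points.\<close>
  have "g x = x + (g a - a)" if "x \<in> A" for x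
    using iso[OF that ab(1)] iso[OF that ab(2)] ab(3,4) by linarith
  then show ?thesis by blast
next
  case no_translation: False
  show ?thesis
  proof (cases "A = {}")
    case False
    then obtain a where a: "a \<in> A" by blast
    have "g x = (g a + a) - x" if x: "x \<in> A" for x
    proof (cases "x = a")
      case False
      then have "a \<noteq> x" by simp
      then have "g x - g a \<noteq> x - a" using no_translation a x by (meson bexI)
      moreover have "g x - g a = x - a \<or> g x - g a = - (x - a)"
        using iso[OF x a] by (simp only: abs_eq_iff)
      ultimately show ?thesis by linarith
    qed simp
    then have "\<forall>x\<in>A. g x = (g a + a) - x" by (rule ballI)
    then show ?thesis by (intro disjI2 exI)
  qed simp
qed

section \<open>Increasing enumerations under translations and reflections\<close>

lemma increasing_enum_exists:
  assumes "finite A"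
  obtains \<tau> where "increasing_enum (card A) \<tau> A"
proof -
  define xs where "xs = sorted_list_of_set A"
  have xs: "sorted_wrt (<) xs" "set xs = A" "length xs = card A"
    using assms by (simp_all add: xs_def)
  \<comment> \<open>The shift by one reconciles enumeration from 1 with list positions from
    0.\<close>
  have "(\<lambda>i. xs ! (i - 1)) ` {1..card A} = A"
  proof (intro equalityI subsetI)
    fix x assume "x \<in> A"
    then obtain i where "i < card A" "x = xs ! i" using xs(2,3) by (metis in_set_conv_nth)
    then show "x \<in> (\<lambda>i. xs ! (i - 1)) ` {1..card A}" by (intro image_eqI[of _ _ "Suc i"]) auto
  next
    fix x assume "x \<in> (\<lambda>i. xs ! (i - 1)) ` {1..card A}"
    then obtain i where "i \<in> {1..card A}" "x = xs ! (i - 1)" by blast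
    then have "i - 1 < length xs" "x = xs ! (i - 1)" using xs(3) by auto
    then show "x \<in> A" using xs(2) by auto
  qed
  moreover have "strict_mono_on {1..card A} (\<lambda>i. xs ! (i - 1))"
  proof (rule strict_mono_onI)
    fix i j assume "i \<in> {1..card A}" "j \<in> {1..card A}" "i < j"
    then have "i - 1 < j - 1" "j - 1 < length xs" using xs(3) by auto
    then show "xs ! (i - 1) < xs ! (j - 1)" by (rule sorted_wrt_nth_less[OF xs(1)])
  qed
  ultimately have "increasing_enum (card A) (\<lambda>i. xs ! (i - 1)) A"
    unfolding increasing_enum_def by simp
  then show ?thesis using that by blast
qed

lemma increasing_enum_translation:
  assumes "increasing_enum s \<tau> A"
  shows "increasing_enum s (\<lambda>i. \<tau> i + e) ((\<lambda>x. x + e) ` A)"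
  using assms unfolding increasing_enum_def strict_mono_on_def by (auto simp: image_image)

text \<open>A reflection reverses the order, and reversing the index by \<open>s - i + 1\<close>, an
  involution of \<open>{1..s}\<close>, makes the enumeration increasing again.\<close>

lemma increasing_enum_reflection:
  assumes "increasing_enum s \<tau> A"
  shows "increasing_enum s (\<lambda>i. e - \<tau> (s - i + 1)) ((\<lambda>x. e - x) ` A)"
proof -
  have "(\<lambda>i. s - i + 1) ` {1..s} = {1..s}"
  proof (intro equalityI subsetI)
    fix x assume "x \<in> {1..s}"
    then show "x \<in> (\<lambda>i. s - i + 1) ` {1..s}" by (intro image_eqI[of _ _ "s - x + 1"]) auto
  qed auto
  then have "(\<lambda>i. e - \<tau> (s - i + 1)) ` {1..s} = (\<lambda>x. e - x) ` \<tau> ` {1..s}"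
    using image_image[of "\<lambda>i. e - \<tau> i" "\<lambda>i. s - i + 1" "{1..s}"] by (simp add: image_image)
  moreover have "strict_mono_on {1..s} (\<lambda>i. e - \<tau> (s - i + 1))"
  proof (rule strict_mono_onI)
    fix i j assume "i \<in> {1..s}" "j \<in> {1..s}" "i < j"
    then have "\<tau> (s - j + 1) < \<tau> (s - i + 1)"
      using assms unfolding increasing_enum_def by (intro strict_mono_onD[of "{1..s}" \<tau>]) auto
    then show "e - \<tau> (s - i + 1) < e - \<tau> (s - j + 1)" by simp
  qed
  ultimately show ?thesis using assms unfolding increasing_enum_def by simp
qed

section \<open>Matching retractions from a pair of contractions\<close>

text \<open>An idempotent power \<open>\<epsilon>\<close> of "first \<open>g\<close>, then
  \<open>h\<close>" retracts \<open>D\<close>. All but the first \<open>g\<close> of that power is a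
  contraction \<open>\<theta>\<close> from \<open>E\<close> to \<open>D\<close> that undoes
  \<open>g\<close> on the image of \<open>\<epsilon>\<close>, so \<open>g\<close> is an isometry
  there and carries the retraction over to \<open>E\<close>.\<close>

lemma retractions_onto_isometric_images:
  fixes f g :: "int \<Rightarrow> int"
  assumes finD: "finite D" and gD: "g ` D \<subseteq> E" and hE: "h ` E \<subseteq> D"
    and gc: "\<And>x y. x \<in> D \<Longrightarrow> y \<in> D \<Longrightarrow> \<bar>g x - g y\<bar> \<le> \<bar>x - y\<bar>"
    and hc: "\<And>x y. x \<in> E \<Longrightarrow> y \<in> E \<Longrightarrow> \<bar>h x - h y\<bar> \<le> \<bar>x - y\<bar>"
    and ag: "\<And>x. x \<in> D \<Longrightarrow> \<alpha> x = \<beta> (g x)" and bh: "\<And>x. x \<in> E \<Longrightarrow> \<beta> x = \<alpha> (h x)"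
  obtains \<epsilon> \<eta> where
    "\<epsilon> ` D \<subseteq> D" "\<And>x. x \<in> D \<Longrightarrow> \<epsilon> (\<epsilon> x) = \<epsilon> x" "\<And>x. x \<in> D \<Longrightarrow> \<alpha> (\<epsilon> x) = \<alpha> x"
    "\<And>x y. x \<in> D \<Longrightarrow> y \<in> D \<Longrightarrow> \<bar>\<epsilon> x - \<epsilon> y\<bar> \<le> \<bar>x - y\<bar>"
    "\<eta> ` E \<subseteq> E" "\<And>x. x \<in> E \<Longrightarrow> \<eta> (\<eta> x) = \<eta> x" "\<And>x. x \<in> E \<Longrightarrow> \<beta> (\<eta> x) = \<beta> x"
    "\<And>x y. x \<in> E \<Longrightarrow> y \<in> E \<Longrightarrow> \<bar>\<eta> x - \<eta> y\<bar> \<le> \<bar>x - y\<bar>"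
    "\<eta> ` E = g ` \<epsilon> ` D"
    "\<And>x y. x \<in> \<epsilon> ` D \<Longrightarrow> y \<in> \<epsilon> ` D \<Longrightarrow> \<bar>g x - g y\<bar> = \<bar>x - y\<bar>"
proof -
  define f where "f x = h (g x)" for x
  have f: "f ` D \<subseteq> D" using gD hE by (simp add: f_def image_subset_iff)
  obtain k where k: "k > 0" "\<And>x. x \<in> D \<Longrightarrow> (f ^^ k) ((f ^^ k) x) = (f ^^ k) x"
    using idempotent_power_on_finite[OF finD f] by blast
  have fc: "\<bar>(f ^^ m) x - (f ^^ m) y\<bar> \<le> \<bar>x - y\<bar>" if "x \<in> D" "y \<in> D" for m x y
  proof (induction m)
    case (Suc m)
    have D: "(f ^^ m) x \<in> D" "(f ^^ m) y \<in> D"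
      using funpow_image_subset[OF f, of m] that by auto
    then have "g ((f ^^ m) x) \<in> E" "g ((f ^^ m) y) \<in> E" using gD by auto
    from hc[OF this] gc[OF D] Suc show ?case
      by (simp add: f_def[of "(f ^^ m) x"] f_def[of "(f ^^ m) y"])
  qed simp
  \<comment> \<open>One round trip gives
    \<open>\<alpha> (h (g x)) = \<beta> (g x) = \<alpha> x\<close>; induction extends this to all
    powers.\<close>
  have fa: "\<alpha> ((f ^^ m) x) = \<alpha> x" if "x \<in> D" for m x
  proof (induction m)
    case (Suc m)
    have D: "(f ^^ m) x \<in> D" using funpow_image_subset[OF f, of m] that by auto
    then have "g ((f ^^ m) x) \<in> E" using gD by auto
    with ag[OF D] bh Suc show ?case by (simp add: f_def[of "(f ^^ m) x"])
  qed simp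
  define \<epsilon> where "\<epsilon> = f ^^ k"
  \<comment> \<open>One power of \<open>f\<close> is held back so that applying \<open>g\<close>
    first restores it, which gives \<open>\<theta> (g x) = \<epsilon> x\<close>; this relies on
    \<open>k > 0\<close>.\<close>
  define \<theta> where "\<theta> = (f ^^ (k - 1)) \<circ> h"
  have \<theta>D: "\<theta> x \<in> D" if "x \<in> E" for x
    using funpow_image_subset[OF f, of "k - 1"] hE that unfolding \<theta>_def by auto
  have \<theta>c: "\<bar>\<theta> x - \<theta> y\<bar> \<le> \<bar>x - y\<bar>" if "x \<in> E" "y \<in> E" for x y
    using fc[of "h x" "h y" "k - 1"] hc[OF that] hE that unfolding \<theta>_def by fastforce
  have \<theta>g: "\<theta> (g x) = \<epsilon> x" for x
  proof -
    have "\<epsilon> x = (f ^^ Suc (k - 1)) x" using k(1) by (simp add: \<epsilon>_def)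
    also have "\<dots> = (f ^^ (k - 1)) (f x)" by (simp add: funpow_swap1)
    finally show ?thesis by (simp add: \<theta>_def f_def[of x])
  qed
  have \<theta>b: "\<alpha> (\<theta> x) = \<beta> x" if "x \<in> E" for x
    using fa[of "h x" "k - 1"] bh[OF that] hE that unfolding \<theta>_def by auto
  \<comment> \<open>The middle \<open>\<epsilon>\<close> secures idempotence: in
    \<open>\<eta> (\<eta> x)\<close> the inner \<open>g\<close> followed by \<open>\<theta>\<close>
    becomes another \<open>\<epsilon>\<close>, which is absorbed.\<close>
  define \<eta> where "\<eta> = g \<circ> \<epsilon> \<circ> \<theta>"
  have \<epsilon>D: "\<epsilon> x \<in> D" if "x \<in> D" for x
    using funpow_image_subset[OF f, of k] that unfolding \<epsilon>_def by auto
  have idem: "\<epsilon> (\<epsilon> x) = \<epsilon> x" if "x \<in> D" for x using k(2)[OF that] by (simp add: \<epsilon>_def)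
  have gE: "g x \<in> E" if "x \<in> D" for x using gD that by auto
  have \<epsilon>c: "\<bar>\<epsilon> x - \<epsilon> y\<bar> \<le> \<bar>x - y\<bar>" if "x \<in> D" "y \<in> D" for x y
    using fc[OF that] by (simp add: \<epsilon>_def)
  show ?thesis
  proof
    show "\<epsilon> ` D \<subseteq> D" using \<epsilon>D by blast
    show "\<epsilon> (\<epsilon> x) = \<epsilon> x" if "x \<in> D" for x using idem[OF that] .
    show "\<alpha> (\<epsilon> x) = \<alpha> x" if "x \<in> D" for x using fa[OF that] by (simp add: \<epsilon>_def)
    show "\<bar>\<epsilon> x - \<epsilon> y\<bar> \<le> \<bar>x - y\<bar>" if "x \<in> D" "y \<in> D" for x y using \<epsilon>c[OF that] .
    show "\<eta> ` E \<subseteq> E" unfolding \<eta>_def using \<theta>D \<epsilon>D gE by auto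
    show "\<eta> (\<eta> x) = \<eta> x" if "x \<in> E" for x
      unfolding \<eta>_def using \<theta>D[OF that] \<epsilon>D by (simp add: \<theta>g idem)
    show "\<beta> (\<eta> x) = \<beta> x" if "x \<in> E" for x
      using \<theta>D[OF that] \<epsilon>D ag[of "\<epsilon> (\<theta> x)"] fa[of "\<theta> x" k] \<theta>b[OF that]
      by (simp add: \<eta>_def \<epsilon>_def)
    show "\<bar>\<eta> x - \<eta> y\<bar> \<le> \<bar>x - y\<bar>" if "x \<in> E" "y \<in> E" for x y
      using \<theta>D[OF that(1)] \<theta>D[OF that(2)] \<epsilon>D \<theta>c[OF that] \<epsilon>c[of "\<theta> x" "\<theta> y"]
        gc[of "\<epsilon> (\<theta> x)" "\<epsilon> (\<theta> y)"] unfolding \<eta>_def by fastforce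
    show "\<eta> ` E = g ` \<epsilon> ` D"
    proof (intro equalityI subsetI)
      fix y assume "y \<in> \<eta> ` E"
      then show "y \<in> g ` \<epsilon> ` D" unfolding \<eta>_def using \<theta>D by auto
    next
      fix y assume "y \<in> g ` \<epsilon> ` D"
      then obtain x where x: "x \<in> D" "y = g (\<epsilon> x)" by blast
      \<comment> \<open>Every point of \<open>g\<close> \<epsilon> \<open>D\<close> is fixed by
        \<open>\<eta>\<close>, hence lies in its image.\<close>
      then have "\<eta> y = y" by (simp add: \<eta>_def \<theta>g idem \<epsilon>D)
      then show "y \<in> \<eta> ` E" using x gE \<epsilon>D by (metis image_eqI)
    qed
    show "\<bar>g x - g y\<bar> = \<bar>x - y\<bar>" if "x \<in> \<epsilon> ` D" "y \<in> \<epsilon> ` D" for x y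
    proof -
      \<comment> \<open>Both points are fixed by \<open>\<epsilon>\<close>, so the distance of
        \<open>x\<close> and \<open>y\<close> is that of \<open>\<theta> (g x)\<close> and
        \<open>\<theta> (g y)\<close>. It is therefore at most the distance of \<open>g x\<close>
        and \<open>g y\<close>, which is at most that of \<open>x\<close> and
        \<open>y\<close>.\<close>
      have xy: "x \<in> D" "y \<in> D" "\<epsilon> x = x" "\<epsilon> y = y" using that \<epsilon>D idem by auto
      then show ?thesis
        using gc[OF xy(1,2)] \<theta>c[OF gE[OF xy(1)] gE[OF xy(2)]] by (simp add: \<theta>g)
    qed
  qed
qed

section \<open>The characterisation of Green's relation\<close>

theorem theorem3p3:
  fixes n p :: nat and \<alpha> \<beta> :: "int \<rightharpoonup> int"
  assumes "1 \<le> p" and "p \<le> n"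
    and "\<alpha> \<in> partial_contractions n" and "\<beta> \<in> partial_contractions n"
    and "card (Ker \<alpha>) = p" and "card (Ker \<beta>) = p"
  shows "(\<alpha>, \<beta>) \<in> green_L pmult (partial_contractions n) \<longleftrightarrow>
    (\<exists>\<gamma>\<^sub>1 \<in> partial_contractions n. \<exists>\<gamma>\<^sub>2 \<in> partial_contractions n. \<exists>s::nat. s \<ge> p \<and>
       refines (dom \<alpha>) (Ker \<gamma>\<^sub>1) (Ker \<alpha>) \<and> card (Ker \<gamma>\<^sub>1) = s \<and>
       refines (dom \<beta>) (Ker \<gamma>\<^sub>2) (Ker \<beta>) \<and> card (Ker \<gamma>\<^sub>2) = s \<and>
       (\<exists>A B \<tau> \<sigma>.
          admissible_transversal (Ker \<gamma>\<^sub>1) A \<and> increasing_enum s \<tau> A \<and>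
          admissible_transversal (Ker \<gamma>\<^sub>2) B \<and> increasing_enum s \<sigma> B \<and>
          ((\<exists>e::int. \<forall>i\<in>{1..s}. \<sigma> i = \<tau> i + e) \<and>
             (\<forall>i\<in>{1..s}. \<alpha> (\<tau> i) = \<beta> (\<sigma> i)) \<or>
           (\<exists>e::int. \<forall>i\<in>{1..s}. \<sigma> (s - i + 1) = e - \<tau> i) \<and>
             (\<forall>i\<in>{1..s}. \<alpha> (\<tau> i) = \<beta> (\<sigma> (s - i + 1))))))"
proof -
  have D: "dom \<alpha> \<subseteq> {1..int n}" and E: "dom \<beta> \<subseteq> {1..int n}"
    using assms(3,4) by (auto simp: partial_contractions_iff)
  show ?thesis (is "?L \<longleftrightarrow> ?R")
  proof
    assume ?L
    then obtain \<gamma> \<delta> where gd: "\<gamma> \<in> partial_contractions n" "\<alpha> = pmult \<gamma> \<beta>"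
        "\<delta> \<in> partial_contractions n" "\<beta> = pmult \<delta> \<alpha>"
      using green_L_partial_contractions_iff[OF assms(3,4)] by blast
    obtain g where g: "g ` dom \<alpha> \<subseteq> dom \<beta>" "\<And>x. x \<in> dom \<alpha> \<Longrightarrow> \<alpha> x = \<beta> (g x)"
        "\<And>x y. x \<in> dom \<alpha> \<Longrightarrow> y \<in> dom \<alpha> \<Longrightarrow> \<bar>g x - g y\<bar> \<le> \<bar>x - y\<bar>"
      using pmult_eq_transfers[OF gd(2,1)] by blast
    obtain h where h: "h ` dom \<beta> \<subseteq> dom \<alpha>" "\<And>x. x \<in> dom \<beta> \<Longrightarrow> \<beta> x = \<alpha> (h x)"
        "\<And>x y. x \<in> dom \<beta> \<Longrightarrow> y \<in> dom \<beta> \<Longrightarrow> \<bar>h x - h y\<bar> \<le> \<bar>x - y\<bar>"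
      using pmult_eq_transfers[OF gd(4,3)] by blast
    have fin: "finite (dom \<alpha>)" using D finite_subset by blast
    obtain \<epsilon> \<eta> where
      \<epsilon>: "\<epsilon> ` dom \<alpha> \<subseteq> dom \<alpha>" "\<And>x. x \<in> dom \<alpha> \<Longrightarrow> \<epsilon> (\<epsilon> x) = \<epsilon> x"
        "\<And>x y. x \<in> dom \<alpha> \<Longrightarrow> y \<in> dom \<alpha> \<Longrightarrow> \<bar>\<epsilon> x - \<epsilon> y\<bar> \<le> \<bar>x - y\<bar>"
      and \<epsilon>\<alpha>: "\<And>x. x \<in> dom \<alpha> \<Longrightarrow> \<alpha> (\<epsilon> x) = \<alpha> x"
      and \<eta>: "\<eta> ` dom \<beta> \<subseteq> dom \<beta>" "\<And>x. x \<in> dom \<beta> \<Longrightarrow> \<eta> (\<eta> x) = \<eta> x"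
        "\<And>x y. x \<in> dom \<beta> \<Longrightarrow> y \<in> dom \<beta> \<Longrightarrow> \<bar>\<eta> x - \<eta> y\<bar> \<le> \<bar>x - y\<bar>"
      and \<eta>\<beta>: "\<And>x. x \<in> dom \<beta> \<Longrightarrow> \<beta> (\<eta> x) = \<beta> x"
      and B: "\<eta> ` dom \<beta> = g ` \<epsilon> ` dom \<alpha>"
      and iso: "\<And>x y. x \<in> \<epsilon> ` dom \<alpha> \<Longrightarrow> y \<in> \<epsilon> ` dom \<alpha> \<Longrightarrow> \<bar>g x - g y\<bar> = \<bar>x - y\<bar>"
      by (rule retractions_onto_isometric_images[of "dom \<alpha>" g "dom \<beta>" h \<alpha> \<beta>,
            OF fin g(1) h(1) g(3) h(3) g(2) h(2)]) (assumption+, blast)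
    \<comment> \<open>The two retractions, read as partial maps, serve as
      \<open>\<gamma>\<^sub>1\<close> and \<open>\<gamma>\<^sub>2\<close>, with their images as
      transversals.\<close>
    let ?\<gamma>1 = "(Some \<circ> \<epsilon>) |` dom \<alpha>" and ?\<gamma>2 = "(Some \<circ> \<eta>) |` dom \<beta>"
    let ?A = "\<epsilon> ` dom \<alpha>"
    note 1 = idempotent_contraction_admissible[OF D \<epsilon>]
    note 2 = idempotent_contraction_admissible[OF E \<eta>, unfolded B]
    have r1: "refines (dom \<alpha>) (Ker ?\<gamma>1) (Ker \<alpha>)"
    proof (rule refines_KerI)
      fix x y assume "x \<in> dom ?\<gamma>1" "?\<gamma>1 x = ?\<gamma>1 y"
      then have "x \<in> dom \<alpha>" "y \<in> dom \<alpha>" "\<epsilon> x = \<epsilon> y"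
        by (auto simp: restrict_map_def split: if_splits)
      then show "\<alpha> x = \<alpha> y" by (metis \<epsilon>\<alpha>)
    qed (auto simp: restrict_map_def split: if_splits)
    have r2: "refines (dom \<beta>) (Ker ?\<gamma>2) (Ker \<beta>)"
    proof (rule refines_KerI)
      fix x y assume "x \<in> dom ?\<gamma>2" "?\<gamma>2 x = ?\<gamma>2 y"
      then have "x \<in> dom \<beta>" "y \<in> dom \<beta>" "\<eta> x = \<eta> y"
        by (auto simp: restrict_map_def split: if_splits)
      then show "\<beta> x = \<beta> y" by (metis \<eta>\<beta>)
    qed (auto simp: restrict_map_def split: if_splits)
    have finA: "finite ?A" using fin by simp
    \<comment> \<open>An isometry is injective, so the two transversals, and with them the two
      kernels, have the same size; this is the number \<open>s\<close>.\<close>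
    have "inj_on g ?A" using iso by (intro inj_onI) fastforce
    then have cB: "card (g ` ?A) = card ?A" by (rule card_image)
    \<comment> \<open>Since \<open>\<alpha> (\<epsilon> x) = \<alpha> x\<close>, all values of
      \<open>\<alpha>\<close> are attained on the transversal, which therefore has at least
      \<open>p\<close> points.\<close>
    have "ran \<alpha> \<subseteq> (\<lambda>x. the (\<alpha> x)) ` ?A"
    proof
      fix y assume "y \<in> ran \<alpha>"
      then obtain x where "\<alpha> x = Some y" by (auto simp: ran_def)
      then have x: "x \<in> dom \<alpha>" "y = the (\<alpha> x)" by auto
      then have "y = the (\<alpha> (\<epsilon> x))" using \<epsilon>\<alpha>[of x] by simp
      with x(1) show "y \<in> (\<lambda>x. the (\<alpha> x)) ` ?A" by blast
    qed
    then have p: "p \<le> card ?A"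
      using assms(5) surj_card_le[OF finA, of "ran \<alpha>"] by (simp add: card_Ker)
    obtain \<tau> where \<tau>: "increasing_enum (card ?A) \<tau> ?A"
      using increasing_enum_exists[OF finA] .
    then have \<tau>A: "\<tau> i \<in> ?A" if "i \<in> {1..card ?A}" for i
      using that unfolding increasing_enum_def by blast
    then have \<tau>\<alpha>: "\<alpha> (\<tau> i) = \<beta> (g (\<tau> i))" if "i \<in> {1..card ?A}" for i
      using g(2)[of "\<tau> i"] \<epsilon>(1) that by blast
    have tr: "(\<exists>e. \<forall>x\<in>?A. g x = x + e) \<or> (\<exists>e. \<forall>x\<in>?A. g x = e - x)"
      by (rule isometry_int_translation_or_reflection) (rule iso)
    have "\<exists>\<sigma>. increasing_enum (card ?A) \<sigma> (g ` ?A) \<and>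
        ((\<exists>e::int. \<forall>i\<in>{1..card ?A}. \<sigma> i = \<tau> i + e) \<and>
           (\<forall>i\<in>{1..card ?A}. \<alpha> (\<tau> i) = \<beta> (\<sigma> i)) \<or>
         (\<exists>e::int. \<forall>i\<in>{1..card ?A}. \<sigma> (card ?A - i + 1) = e - \<tau> i) \<and>
           (\<forall>i\<in>{1..card ?A}. \<alpha> (\<tau> i) = \<beta> (\<sigma> (card ?A - i + 1))))"
      using tr
    proof (elim disjE exE)
      fix e assume e: "\<forall>x\<in>?A. g x = x + e"
      then have "g ` ?A = (\<lambda>x. x + e) ` ?A" by (intro image_cong refl) (rule bspec)
      then have "increasing_enum (card ?A) (\<lambda>i. \<tau> i + e) (g ` ?A)"
        using increasing_enum_translation[OF \<tau>] by simp
      moreover have "\<forall>i\<in>{1..card ?A}. \<alpha> (\<tau> i) = \<beta> (\<tau> i + e)"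
        using \<tau>\<alpha> \<tau>A e by metis
      ultimately show ?thesis by blast
    next
      fix e assume e: "\<forall>x\<in>?A. g x = e - x"
      \<comment> \<open>The index is reversed here so that \<open>\<sigma>\<close> increases;
        reversing it once more recovers the pairing of \<open>\<tau> i\<close> with
        \<open>e - \<tau> i\<close>.\<close>
      define \<sigma> where "\<sigma> = (\<lambda>i. e - \<tau> (card ?A - i + 1))"
      from e have "g ` ?A = (\<lambda>x. e - x) ` ?A" by (intro image_cong refl) (rule bspec)
      then have "increasing_enum (card ?A) \<sigma> (g ` ?A)"
        using increasing_enum_reflection[OF \<tau>] by (simp add: \<sigma>_def)
      moreover have "\<forall>i\<in>{1..card ?A}. \<sigma> (card ?A - i + 1) = e - \<tau> i" by (auto simp: \<sigma>_def)
      moreover from this have "\<forall>i\<in>{1..card ?A}. \<alpha> (\<tau> i) = \<beta> (\<sigma> (card ?A - i + 1))"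
        using \<tau>\<alpha> \<tau>A e by simp
      ultimately show ?thesis by blast
    qed
    then obtain \<sigma> where \<sigma>: "increasing_enum (card ?A) \<sigma> (g ` ?A)" and
        "(\<exists>e::int. \<forall>i\<in>{1..card ?A}. \<sigma> i = \<tau> i + e) \<and>
           (\<forall>i\<in>{1..card ?A}. \<alpha> (\<tau> i) = \<beta> (\<sigma> i)) \<or>
         (\<exists>e::int. \<forall>i\<in>{1..card ?A}. \<sigma> (card ?A - i + 1) = e - \<tau> i) \<and>
           (\<forall>i\<in>{1..card ?A}. \<alpha> (\<tau> i) = \<beta> (\<sigma> (card ?A - i + 1)))"
      by (elim exE conjE)
    with r1 r2 1(2,3) 2(2) \<tau> p 2(3)[unfolded cB] show ?R
      by (intro bexI[OF _ 1(1)] bexI[OF _ 2(1)] exI[of _ "card ?A"] exI[of _ ?A]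
          exI[of _ "g ` ?A"] exI[of _ \<tau>] exI[of _ \<sigma>] conjI)
  next
    assume ?R
    then show ?L
    proof (elim bexE exE conjE)
      fix \<gamma>\<^sub>1 \<gamma>\<^sub>2 s A B \<tau> \<sigma>
      assume r: "refines (dom \<alpha>) (Ker \<gamma>\<^sub>1) (Ker \<alpha>)" "refines (dom \<beta>) (Ker \<gamma>\<^sub>2) (Ker \<beta>)"
        and adm: "admissible_transversal (Ker \<gamma>\<^sub>1) A" "admissible_transversal (Ker \<gamma>\<^sub>2) B"
        and enum: "increasing_enum s \<tau> A" "increasing_enum s \<sigma> B"
        and cases: "((\<exists>e::int. \<forall>i\<in>{1..s}. \<sigma> i = \<tau> i + e) \<and>
               (\<forall>i\<in>{1..s}. \<alpha> (\<tau> i) = \<beta> (\<sigma> i)) \<or>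
             (\<exists>e::int. \<forall>i\<in>{1..s}. \<sigma> (s - i + 1) = e - \<tau> i) \<and>
               (\<forall>i\<in>{1..s}. \<alpha> (\<tau> i) = \<beta> (\<sigma> (s - i + 1))))"
      have A: "A = \<tau> ` {1..s}" and B: "B = \<sigma> ` {1..s}"
        using enum unfolding increasing_enum_def by simp_all
      \<comment> \<open>Both alternatives reduce to a pair of mutually inverse isometries of the
        integers that match \<open>\<alpha>\<close> on \<open>A\<close> with \<open>\<beta>\<close>
        on \<open>B\<close>; a reflection is its own inverse.\<close>
      have "\<exists>f f'. (\<forall>a\<in>A. \<alpha> a = \<beta> (f a)) \<and> (\<forall>b\<in>B. \<beta> b = \<alpha> (f' b)) \<and>
          (\<forall>a b. \<bar>f a - f b\<bar> = \<bar>a - b\<bar>) \<and> (\<forall>a b. \<bar>f' a - f' b\<bar> = \<bar>a - b\<bar>)"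
        using cases
      proof (elim disjE conjE exE)
        fix e assume e: "\<forall>i\<in>{1..s}. \<sigma> i = \<tau> i + e" and eq: "\<forall>i\<in>{1..s}. \<alpha> (\<tau> i) = \<beta> (\<sigma> i)"
        show ?thesis
          by (rule exI[of _ "\<lambda>x. x + e"], rule exI[of _ "\<lambda>x. x - e"]) (use e eq A B in auto)
      next
        fix e assume e: "\<forall>i\<in>{1..s}. \<sigma> (s - i + 1) = e - \<tau> i"
          and eq: "\<forall>i\<in>{1..s}. \<alpha> (\<tau> i) = \<beta> (\<sigma> (s - i + 1))"
        have "\<forall>b\<in>B. \<beta> b = \<alpha> (e - b)"
        proof
          fix b assume "b \<in> B"
          then obtain j where j: "j \<in> {1..s}" "b = \<sigma> j" using B by blast
          \<comment> \<open>The reflected pairing is stated from the side of \<open>\<tau>\<close>;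
            this is the index whose partner is \<open>\<sigma> j\<close>.\<close>
          define i where "i = s - j + 1"
          have "i \<in> {1..s}" "s - i + 1 = j" using j(1) by (auto simp: i_def)
          then show "\<beta> b = \<alpha> (e - b)" using e eq j(2) by fastforce
        qed
        moreover have "\<forall>a\<in>A. \<alpha> a = \<beta> (e - a)" using e eq A by auto
        ultimately show ?thesis
          by (intro exI[of _ "\<lambda>x. e - x"]) auto
      qed
      then obtain f f' where f: "\<And>a. a \<in> A \<Longrightarrow> \<alpha> a = \<beta> (f a)" "\<And>b. b \<in> B \<Longrightarrow> \<beta> b = \<alpha> (f' b)"
        "\<And>a b. \<bar>f a - f b\<bar> = \<bar>a - b\<bar>" "\<And>a b. \<bar>f' a - f' b\<bar> = \<bar>a - b\<bar>" by blast
      show ?L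
        unfolding green_L_partial_contractions_iff[OF assms(3,4)]
        \<comment> \<open>The same construction is applied twice, with the roles of
          \<open>\<alpha>\<close> and \<open>\<beta>\<close> exchanged, and gives the two
          divisibilities.\<close>
        using factor_through_admissible_transversal[OF assms(3,4) r(1) adm(1), of f]
          factor_through_admissible_transversal[OF assms(4,3) r(2) adm(2), of f'] f by simp
    qed
  qed
qed

end
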